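(* Let $\mu>0$ be a constant, let $h:\mathbb{R}\to\mathbb{R}$ and $\gamma:[0,1]\to\mathbb{R}$ be $C^\infty$-smooth functions, and let $\varphi:[0,1]\to\mathbb{R}$ be a continuous function. Consider the problem $$(\partial_t+\partial_x+\mu)u=0,\quad (x,t)\in[0,1]\times[0,\infty),$$ $$u(x,0)=\varphi(x),\quad x\in[0,1],$$ $$u(0,t)=h\left(\int_0^1\gamma(x)u(x,t)\,dx\right),\quad t>0.$$ Then any continuous solution $u$ (in the integrated sense defined in the context) to this problem is smoothing, i.e., for every $k\in\mathbb{N}$ there exists $T>0$ such that $u\in C^k([0,1]\times[T,\infty))$.
   Context: A continuous solution of the problem is a continuous function $u:[0,1]\times[0,\infty)\to\mathbb{R}$ satisfying the equation obtained by integration along the characteristic lines: for all $(x,t)\in[0,1]\times[0,\infty)$, $$u(x,t)=\begin{cases} e^{-\mu x}\,h\left(\displaystyle\int_0^1\gamma(\xi)u(\xi,t-x)\,d\xi\right) & \text{if } t>x,\\[2mm] e^{-\mu t}\,\varphi(x-t) & \text{if } t\le x.\end{cases}$$ *)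

theory Defs
  imports "HOL-Analysis.Analysis"
begin

text \<open>
  \<open>Ck_on k f S\<close>: \<open>f\<close> is \<open>k\<close> times continuously differentiable on \<open>S\<close>. Derivatives are taken
  \<open>within S\<close>, so they are one-sided at boundary points and are required to be continuous up to
  the boundary; only the values of \<open>f\<close> on \<open>S\<close> matter. The gradient \<open>g\<close> lists the
  first-order partial derivatives. The notion is meant for sets on which the derivative within
  \<open>S\<close> is unique, such as open sets and convex sets with nonempty interior.
\<close>

primrec Ck_on :: "nat \<Rightarrow> ('a::euclidean_space \<Rightarrow> real) \<Rightarrow> 'a set \<Rightarrow> bool" where
  "Ck_on 0 f S \<longleftrightarrow> continuous_on S f"
| "Ck_on (Suc k) f S \<longleftrightarrow>
     (\<exists>g :: 'a \<Rightarrow> 'a.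
        (\<forall>x\<in>S. (f has_derivative (\<lambda>v. g x \<bullet> v)) (at x within S)) \<and>
        (\<forall>b\<in>Basis. Ck_on k (\<lambda>x. g x \<bullet> b) S))"

definition Cinf_on :: "('a::euclidean_space \<Rightarrow> real) \<Rightarrow> 'a set \<Rightarrow> bool" where
  "Cinf_on f S \<longleftrightarrow> (\<forall>k. Ck_on k f S)"

text \<open>
  Continuous solution, in the sense of integration along characteristic lines, of
  \[ (\partial_t + \partial_x + \mu) u = 0, \qquad u(x,0) = \varphi(x), \qquad
     u(0,t) = h\Bigl(\int_0^1 \gamma(x) u(x,t)\, dx\Bigr) \]
  on \<open>[0,1] \<times> [0,\<infinity>)\<close>. The argument of \<open>u\<close> is the pair \<open>(x, t)\<close>; only the values of
  \<open>u\<close> on \<open>[0,1] \<times> [0,\<infinity>)\<close> and of \<open>\<gamma>\<close>, \<open>\<phi>\<close> on \<open>[0,1]\<close> are used.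
\<close>

definition continuous_solution ::
  "real \<Rightarrow> (real \<Rightarrow> real) \<Rightarrow> (real \<Rightarrow> real) \<Rightarrow> (real \<Rightarrow> real) \<Rightarrow> (real \<times> real \<Rightarrow> real) \<Rightarrow> bool" where
  "continuous_solution \<mu> h \<gamma> \<phi> u \<longleftrightarrow>
     continuous_on ({0..1} \<times> {0..}) u \<and>
     (\<forall>x\<in>{0..1}. \<forall>t\<in>{0..}.
        u (x, t) = (if t > x
                    then exp (- \<mu> * x) * h (integral {0..1} (\<lambda>\<xi>. \<gamma> \<xi> * u (\<xi>, t - x)))
                    else exp (- \<mu> * t) * \<phi> (x - t)))"

end

theory Submission
  imports Defs
begin

text \<open>
  For \<open>t > 1\<close> the initial data has left the strip, so \<open>u\<close> is determined by its boundary values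
  \<open>B t = u (0, t)\<close>: \<open>u (x, t) = exp (- \<mu> * x) * B (t - x)\<close>. Inserting this into the boundary
  condition gives the scalar delay equation \<open>B = h \<circ> window_conv \<kappa> B\<close> with
  \<open>\<kappa> \<xi> = \<gamma> \<xi> * exp (- \<mu> * \<xi>)\<close>, where \<open>window_conv \<kappa> B t\<close> averages \<open>B\<close> over
  \<open>[t - 1, t]\<close> with weight \<open>\<kappa>\<close>.

  This averaging gains one derivative: if \<open>B\<close> is \<open>C\<^sup>k\<close> on \<open>[T, \<infinity>)\<close>, then
  \<open>window_conv \<kappa> B\<close> is \<open>C\<^bsup>k+1\<^esup>\<close> on \<open>[T + 1, \<infinity>)\<close> (\<open>Ck_on_Suc_window_conv\<close>). The
  reason is that \<open>B\<close> has an antiderivative of class \<open>C\<^bsup>k+1\<^esup>\<close>, and integration by parts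
  (\<open>window_conv_by_parts\<close>) moves the derivative from it onto \<open>\<kappa>\<close>; what remains are boundary
  terms and an average of the antiderivative, and averaging against a continuous weight preserves
  smoothness (\<open>Ck_on_window_conv\<close>). As \<open>h\<close> is smooth, each further unit of time
  therefore gives \<open>B\<close> one more derivative (\<open>delay_equation_smoothing\<close>), and the formula for
  \<open>u\<close> in terms of \<open>B\<close> carries this over to \<open>u\<close>.
\<close>

section \<open>Calculus of \<open>Ck_on\<close>\<close>

lemma Ck_on_cong:
  assumes "\<And>x. x \<in> S \<Longrightarrow> f x = g x"
  shows "Ck_on k f S \<longleftrightarrow> Ck_on k g S"
proof (cases k)
  case 0
  then show ?thesis using assms by (simp cong: continuous_on_cong)
next
  case (Suc n)
  have "(f has_derivative D) (at x within S) \<longleftrightarrow> (g has_derivative D) (at x within S)"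
    if "x \<in> S" for x D
    using that assms has_derivative_transform[of x S f g D] has_derivative_transform[of x S g f D]
    by auto
  with Suc show ?thesis by simp
qed

lemma Ck_on_imp_continuous_on:
  assumes "Ck_on k f S"
  shows "continuous_on S f"
proof (cases k)
  case (Suc n)
  then show ?thesis
    using assms by (auto intro: has_derivative_continuous_on)
qed (use assms in simp)

lemma Ck_on_SucD:
  assumes "Ck_on (Suc k) f S"
  shows "Ck_on k f S"
  using assms
proof (induction k arbitrary: f)
  case 0
  show ?case using Ck_on_imp_continuous_on[OF 0] by simp
next
  case (Suc k)
  from Suc.prems obtain g where g: "\<forall>x\<in>S. (f has_derivative (\<lambda>v. g x \<bullet> v)) (at x within S)"
      "\<forall>b\<in>Basis. Ck_on (Suc k) (\<lambda>x. g x \<bullet> b) S"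
    unfolding Ck_on.simps(2)[of "Suc k"] by auto
  have "\<forall>b\<in>Basis. Ck_on k (\<lambda>x. g x \<bullet> b) S" using g(2) Suc.IH by blast
  with g(1) show ?case by auto
qed

lemma Ck_on_const: "Ck_on k (\<lambda>x. c) S"
proof (induction k arbitrary: c)
  case (Suc k)
  have "Ck_on k (\<lambda>x. (0::'a) \<bullet> b) S" for b :: 'a using Suc.IH[of 0] by simp
  then show ?case by (auto intro!: exI[of _ "\<lambda>x. 0"])
qed simp

lemma Ck_on_inner_left: "Ck_on k (\<lambda>x. c \<bullet> x) S"
proof (cases k)
  case 0
  then show ?thesis by (auto intro!: continuous_intros)
next
  case (Suc n)
  then show ?thesis
    by (auto intro!: exI[of _ "\<lambda>x. c"] derivative_eq_intros Ck_on_const)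
qed

lemma Ck_on_add:
  assumes "Ck_on k f S" "Ck_on k g S"
  shows "Ck_on k (\<lambda>x. f x + g x) S"
  using assms
proof (induction k arbitrary: f g)
  case 0
  then show ?case by (auto intro!: continuous_intros)
next
  case (Suc k)
  then obtain f' g' where
      f: "\<forall>x\<in>S. (f has_derivative (\<lambda>v. f' x \<bullet> v)) (at x within S)"
        "\<forall>b\<in>Basis. Ck_on k (\<lambda>x. f' x \<bullet> b) S" and
      g: "\<forall>x\<in>S. (g has_derivative (\<lambda>v. g' x \<bullet> v)) (at x within S)"
        "\<forall>b\<in>Basis. Ck_on k (\<lambda>x. g' x \<bullet> b) S"
    by auto
  have "\<forall>x\<in>S. ((\<lambda>x. f x + g x) has_derivative (\<lambda>v. (f' x + g' x) \<bullet> v)) (at x within S)"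
    using f(1) g(1) by (auto intro!: derivative_eq_intros simp: inner_add_left)
  moreover have "\<forall>b\<in>Basis. Ck_on k (\<lambda>x. (f' x + g' x) \<bullet> b) S"
    using f(2) g(2) Suc.IH by (simp add: inner_add_left)
  ultimately show ?case by (auto intro!: exI[of _ "\<lambda>x. f' x + g' x"])
qed

lemma Ck_on_mult:
  assumes "Ck_on k f S" "Ck_on k g S"
  shows "Ck_on k (\<lambda>x. f x * g x) S"
  using assms
proof (induction k arbitrary: f g)
  case 0
  then show ?case by (auto intro!: continuous_intros)
next
  case (Suc k)
  then obtain f' g' where
      f: "\<forall>x\<in>S. (f has_derivative (\<lambda>v. f' x \<bullet> v)) (at x within S)"
        "\<forall>b\<in>Basis. Ck_on k (\<lambda>x. f' x \<bullet> b) S" and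
      g: "\<forall>x\<in>S. (g has_derivative (\<lambda>v. g' x \<bullet> v)) (at x within S)"
        "\<forall>b\<in>Basis. Ck_on k (\<lambda>x. g' x \<bullet> b) S"
    by auto
  define G where "G x = f x *\<^sub>R g' x + g x *\<^sub>R f' x" for x
  have "\<forall>x\<in>S. ((\<lambda>x. f x * g x) has_derivative (\<lambda>v. G x \<bullet> v)) (at x within S)"
    using f(1) g(1)
    by (auto intro!: derivative_eq_intros simp: G_def inner_add_left)
  moreover have "Ck_on k (\<lambda>x. G x \<bullet> b) S" if "b \<in> Basis" for b
    using that f(2) g(2) Suc.IH Suc.prems[THEN Ck_on_SucD]
    by (simp add: G_def inner_add_left Ck_on_add)
  ultimately show ?case by (auto intro!: exI[of _ G])
qed

lemma Ck_on_Suc_realI: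
  fixes f :: "real \<Rightarrow> real"
  assumes "\<And>x. x \<in> S \<Longrightarrow> (f has_real_derivative f' x) (at x within S)" and "Ck_on k f' S"
  shows "Ck_on (Suc k) f S"
  using assms by (auto simp: has_field_derivative_def intro!: exI[of _ f'])

lemma Ck_on_Suc_realE:
  fixes f :: "real \<Rightarrow> real"
  assumes "Ck_on (Suc k) f S"
  obtains f' where "\<And>x. x \<in> S \<Longrightarrow> (f has_real_derivative f' x) (at x within S)" "Ck_on k f' S"
  using assms by (auto simp: has_field_derivative_def)

text \<open>
  Induction on \<open>k\<close> through the chain rule: the gradient of \<open>h \<circ> f\<close> is \<open>h' \<circ> f\<close> times the
  gradient of \<open>f\<close>. The induction hypothesis is needed for \<open>h'\<close> with the same inner function,
  hence \<open>h\<close> is arbitrary in the induction, while \<open>f\<close> stays fixed.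
\<close>

lemma Ck_on_compose:
  fixes h :: "real \<Rightarrow> real"
  assumes "Ck_on k h R" "Ck_on k f S" "f ` S \<subseteq> R"
  shows "Ck_on k (\<lambda>x. h (f x)) S"
  using assms(1,2)
proof (induction k arbitrary: h)
  case 0
  then show ?case using assms(3) by (auto intro: continuous_on_compose2)
next
  case (Suc k)
  obtain h' where h: "\<And>x. x \<in> R \<Longrightarrow> (h has_real_derivative h' x) (at x within R)"
      "Ck_on k h' R"
    using Ck_on_Suc_realE[OF Suc.prems(1)] by blast
  obtain f' where f: "\<forall>x\<in>S. (f has_derivative (\<lambda>v. f' x \<bullet> v)) (at x within S)"
      "\<forall>b\<in>Basis. Ck_on k (\<lambda>x. f' x \<bullet> b) S"
    using Suc.prems(2) by auto
  have "((\<lambda>x. h (f x)) has_derivative (\<lambda>v. (h' (f x) *\<^sub>R f' x) \<bullet> v)) (at x within S)"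
    if "x \<in> S" for x
    using has_derivative_in_compose2[of R h "\<lambda>x v. h' x * v" f S x "\<lambda>v. f' x \<bullet> v"]
      h(1) f(1) assms(3) that
    by (simp add: has_field_derivative_def)
  moreover have "Ck_on k (\<lambda>x. (h' (f x) *\<^sub>R f' x) \<bullet> b) S" if "b \<in> Basis" for b
    using that f(2) Suc.IH[OF h(2)] Suc.prems(2)[THEN Ck_on_SucD]
    by (simp add: Ck_on_mult)
  ultimately show ?case by (auto intro!: exI[of _ "\<lambda>x. h' (f x) *\<^sub>R f' x"])
qed

lemma Ck_on_exp: "Ck_on k (exp :: real \<Rightarrow> real) UNIV"
proof (induction k)
  case (Suc k)
  show ?case by (rule Ck_on_Suc_realI[OF _ Suc]) (auto intro: DERIV_exp)
qed (auto intro!: continuous_intros)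

lemma Ck_on_shift:
  fixes f :: "real \<Rightarrow> real"
  assumes "Ck_on k f {T..}" "0 \<le> s" "s \<le> 1"
  shows "Ck_on k (\<lambda>t. f (t - s)) {T+1..}"
proof -
  have "Ck_on k (\<lambda>t. 1 \<bullet> t + - s) {T+1..}"
    by (intro Ck_on_add Ck_on_inner_left Ck_on_const)
  from Ck_on_compose[OF assms(1) this] assms(2,3) show ?thesis by (auto simp: image_subset_iff)
qed

section \<open>Convolution with a kernel on the unit interval\<close>

definition window_conv :: "(real \<Rightarrow> real) \<Rightarrow> (real \<Rightarrow> real) \<Rightarrow> real \<Rightarrow> real" where
  "window_conv \<kappa> f t = integral {0..1} (\<lambda>\<xi>. \<kappa> \<xi> * f (t - \<xi>))"

lemma continuous_on_window_integrand:
  fixes \<kappa> f :: "real \<Rightarrow> real"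
  assumes "continuous_on {0..1} \<kappa>" "continuous_on {T..} f"
  shows "continuous_on ({T+1..} \<times> {0..1}) (\<lambda>(t, \<xi>). \<kappa> \<xi> * f (t - \<xi>))"
  unfolding case_prod_unfold
  by (intro continuous_on_mult continuous_on_compose2[OF assms(1)]
      continuous_on_compose2[OF assms(2)] continuous_intros) auto

lemma window_integrand_integrable:
  fixes \<kappa> f :: "real \<Rightarrow> real"
  assumes "continuous_on {0..1} \<kappa>" "continuous_on {T..} f" "T + 1 \<le> t"
  shows "(\<lambda>\<xi>. \<kappa> \<xi> * f (t - \<xi>)) integrable_on {0..1}"
  using assms(3)
  by (intro integrable_continuous_interval continuous_on_mult assms(1)
      continuous_on_compose2[OF assms(2)] continuous_intros) auto

text \<open>
  The variable \<open>t\<close> enters the integrand only through \<open>f\<close>, so differentiating under the integral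
  sign replaces \<open>f\<close> by its derivative and leaves \<open>\<kappa>\<close> alone. The domain shrinks by the
  length of the window, since \<open>t - \<xi>\<close> has to stay in \<open>[T, \<infinity>)\<close>.
\<close>

lemma Ck_on_window_conv:
  assumes "continuous_on {0..1} \<kappa>" "Ck_on k f {T..}"
  shows "Ck_on k (window_conv \<kappa> f) {T+1..}"
  using assms(2)
proof (induction k arbitrary: f)
  case 0
  then have "continuous_on {T+1..} (\<lambda>t. integral (cbox 0 1) (\<lambda>\<xi>. \<kappa> \<xi> * f (t - \<xi>)))"
    using continuous_on_window_integrand[OF assms(1)]
    by (intro integral_continuous_on_param) auto
  then show ?case by (simp add: window_conv_def[abs_def])
next
  case (Suc k)
  obtain f' where f': "\<And>x. x \<in> {T..} \<Longrightarrow> (f has_real_derivative f' x) (at x within {T..})"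
      "Ck_on k f' {T..}"
    using Ck_on_Suc_realE[OF Suc.prems] by blast
  have cf: "continuous_on {T..} f"
    using Ck_on_imp_continuous_on[OF Suc.prems] .
  have cf': "continuous_on {T..} f'"
    using Ck_on_imp_continuous_on[OF f'(2)] .
  have "(window_conv \<kappa> f has_real_derivative window_conv \<kappa> f' t) (at t within {T+1..})"
    if t: "t \<in> {T+1..}" for t
  proof -
    have "((\<lambda>t. \<kappa> \<xi> * f (t - \<xi>)) has_real_derivative \<kappa> \<xi> * f' (t - \<xi>)) (at t within {T+1..})"
      if "t \<in> {T+1..}" "\<xi> \<in> cbox 0 1" for t \<xi>
    proof -
      have outer: "(f has_real_derivative f' (t - \<xi>)) (at (t - \<xi>) within (\<lambda>t. t - \<xi>) ` {T+1..})"
        using that by (intro has_field_derivative_subset[OF f'(1)]) auto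
      have inner: "((\<lambda>t. t - \<xi>) has_real_derivative 1) (at t within {T+1..})"
        by (auto intro!: derivative_eq_intros)
      have "((\<lambda>t. f (t - \<xi>)) has_real_derivative f' (t - \<xi>)) (at t within {T+1..})"
        using DERIV_image_chain[OF outer inner] by (simp add: o_def)
      then show ?thesis by (rule DERIV_cmult)
    qed
    moreover have "(\<lambda>\<xi>. \<kappa> \<xi> * f (t - \<xi>)) integrable_on cbox 0 1" if "t \<in> {T+1..}" for t
      using window_integrand_integrable[OF assms(1) cf] that by simp
    moreover have "continuous_on ({T+1..} \<times> cbox 0 1) (\<lambda>(t, \<xi>). \<kappa> \<xi> * f' (t - \<xi>))"
      using continuous_on_window_integrand[OF assms(1) cf'] by simp
    ultimately have "((\<lambda>t. integral (cbox 0 1) (\<lambda>\<xi>. \<kappa> \<xi> * f (t - \<xi>))) has_real_derivative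
        integral (cbox 0 1) (\<lambda>\<xi>. \<kappa> \<xi> * f' (t - \<xi>))) (at t within {T+1..})"
      by (rule leibniz_rule_field_derivative) (use t in auto)
    then show ?thesis by (simp add: window_conv_def[abs_def])
  qed
  then show ?case using Suc.IH[OF f'(2)] by (rule Ck_on_Suc_realI)
qed

lemma has_derivative_integral_halfline:
  fixes f :: "real \<Rightarrow> real"
  assumes "continuous_on {T..} f" "T \<le> t"
  shows "((\<lambda>t. integral {T..t} f) has_real_derivative f t) (at t within {T..})"
proof -
  have "((\<lambda>t. integral {T..t} f) has_real_derivative f t) (at t within {T..t+1})"
    using assms
    by (intro integral_has_real_derivative continuous_on_subset[OF assms(1)]) auto
  \<comment> \<open>The fundamental theorem is about compact intervals; \<open>{T..t+1}\<close> and \<open>{T..}\<close> agree near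
    \<open>t\<close>.\<close>
  moreover have "at t within {T..t+1} = at t within {T..}"
    by (rule at_within_nhd[of _ "{..<t+1}"]) auto
  ultimately show ?thesis by simp
qed

lemma Ck_on_integral_halfline:
  fixes f :: "real \<Rightarrow> real"
  assumes "Ck_on k f {T..}"
  shows "Ck_on (Suc k) (\<lambda>t. integral {T..t} f) {T..}"
proof -
  have "continuous_on {T..} f"
    using Ck_on_imp_continuous_on[OF assms] .
  then show ?thesis
    using has_derivative_integral_halfline assms by (intro Ck_on_Suc_realI) auto
qed

text \<open>
  On the right-hand side only the antiderivative \<open>F\<close> of \<open>f\<close> depends on \<open>t\<close>, and it is one order
  smoother than \<open>f\<close>.
\<close>

lemma window_conv_by_parts:
  assumes \<kappa>: "\<And>\<xi>. \<xi> \<in> {0..1} \<Longrightarrow> (\<kappa> has_real_derivative \<kappa>' \<xi>) (at \<xi> within {0..1})"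
      "continuous_on {0..1} \<kappa>'"
    and F: "\<And>s. s \<in> {T..} \<Longrightarrow> (F has_real_derivative f s) (at s within {T..})"
      "continuous_on {T..} f"
    and t: "T + 1 \<le> t"
  shows "window_conv \<kappa> f t = \<kappa> 0 * F t - \<kappa> 1 * F (t - 1) + window_conv \<kappa>' F t"
proof -
  define P where "P \<xi> = - \<kappa> \<xi> * F (t - \<xi>)" for \<xi>
  have P: "(P has_vector_derivative (\<kappa> \<xi> * f (t - \<xi>) - \<kappa>' \<xi> * F (t - \<xi>))) (at \<xi> within {0..1})"
    if "\<xi> \<in> {0..1}" for \<xi>
  proof -
    have outer: "(F has_real_derivative f (t - \<xi>)) (at (t - \<xi>) within (\<lambda>\<xi>. t - \<xi>) ` {0..1})"
      using that t by (intro has_field_derivative_subset[OF F(1)]) auto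
    have inner: "((\<lambda>\<xi>. t - \<xi>) has_real_derivative -1) (at \<xi> within {0..1})"
      by (auto intro!: derivative_eq_intros)
    have "((\<lambda>\<xi>. F (t - \<xi>)) has_real_derivative - f (t - \<xi>)) (at \<xi> within {0..1})"
      using DERIV_image_chain[OF outer inner] by (simp add: o_def)
    with \<kappa>(1)[OF that] have "(P has_real_derivative (\<kappa> \<xi> * f (t - \<xi>) - \<kappa>' \<xi> * F (t - \<xi>))) (at \<xi> within {0..1})"
      unfolding P_def[abs_def] by (auto intro!: derivative_eq_intros simp: algebra_simps)
    then show ?thesis by (simp add: has_real_derivative_iff_has_vector_derivative)
  qed
  have "((\<lambda>\<xi>. \<kappa> \<xi> * f (t - \<xi>) - \<kappa>' \<xi> * F (t - \<xi>)) has_integral P 1 - P 0) {0..1}"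
    using P by (intro fundamental_theorem_of_calculus) auto
  moreover have "continuous_on {0..1} \<kappa>" "continuous_on {T..} F"
    using DERIV_continuous_on[OF \<kappa>(1)] DERIV_continuous_on[OF F(1)] by auto
  then have "(\<lambda>\<xi>. \<kappa> \<xi> * f (t - \<xi>)) integrable_on {0..1}"
      "(\<lambda>\<xi>. \<kappa>' \<xi> * F (t - \<xi>)) integrable_on {0..1}"
    using window_integrand_integrable \<kappa>(2) F(2) t by blast+
  ultimately show ?thesis
    by (auto dest!: integral_unique simp: integral_diff window_conv_def P_def)
qed

text \<open>
  The gain of one derivative: every term of \<open>window_conv_by_parts\<close>, applied to
  \<open>F t = integral {T..t} f\<close>, is as smooth as \<open>F\<close>. One continuous derivative of the kernel is
  enough for every \<open>k\<close>, because the derivatives in \<open>t\<close> always fall on \<open>F\<close>.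
\<close>

lemma Ck_on_Suc_window_conv:
  assumes \<kappa>: "Ck_on 1 \<kappa> {0..1}" and f: "Ck_on k f {T..}"
  shows "Ck_on (Suc k) (window_conv \<kappa> f) {T+1..}"
proof -
  obtain \<kappa>' where \<kappa>': "\<And>\<xi>. \<xi> \<in> {0..1} \<Longrightarrow> (\<kappa> has_real_derivative \<kappa>' \<xi>) (at \<xi> within {0..1})"
      "continuous_on {0..1} \<kappa>'"
    using Ck_on_Suc_realE[of 0 \<kappa> "{0..1}"] \<kappa> by auto
  define F where "F t = integral {T..t} f" for t
  have cf: "continuous_on {T..} f"
    using Ck_on_imp_continuous_on[OF f] .
  have F': "(F has_real_derivative f s) (at s within {T..})" if "s \<in> {T..}" for s
    using has_derivative_integral_halfline[OF cf] that by (simp add: F_def[abs_def])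
  have F: "Ck_on (Suc k) F {T..}"
    using Ck_on_integral_halfline[OF f] by (simp only: F_def[abs_def])
  \<comment> \<open>The term \<open>F t\<close> is written \<open>F (t - 0)\<close> so that both boundary terms are shifts by an amount
    in \<open>[0, 1]\<close>.\<close>
  have "Ck_on (Suc k) (\<lambda>t. \<kappa> 0 * F (t - 0) + - \<kappa> 1 * F (t - 1) + window_conv \<kappa>' F t) {T+1..}"
    using F \<kappa>'(2) by (intro Ck_on_add Ck_on_mult Ck_on_const Ck_on_shift Ck_on_window_conv) auto
  then show ?thesis
    using window_conv_by_parts[OF \<kappa>' F' cf]
    by (subst Ck_on_cong[where g = "\<lambda>t. \<kappa> 0 * F (t - 0) + - \<kappa> 1 * F (t - 1) + window_conv \<kappa>' F t"])
      auto
qed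

section \<open>Smoothing\<close>

text \<open>
  Bootstrapping: inserting the regularity already known into the right-hand side of
  \<open>B = h \<circ> window_conv \<kappa> B\<close> returns one more derivative, at the cost of one window
  length.
\<close>

lemma delay_equation_smoothing:
  assumes B: "\<And>t. t > T \<Longrightarrow> B t = h (window_conv \<kappa> B t)" "continuous_on {T..} B"
    and h: "Cinf_on h UNIV" and \<kappa>: "Ck_on 1 \<kappa> {0..1}"
  shows "Ck_on k B {T + real k..}"
proof (induction k)
  case 0
  then show ?case using B(2) by simp
next
  case (Suc k)
  have "Ck_on (Suc k) h UNIV" using h by (simp only: Cinf_on_def)
  from Ck_on_compose[OF this Ck_on_Suc_window_conv[OF \<kappa> Suc]]
  have "Ck_on (Suc k) (\<lambda>t. h (window_conv \<kappa> B t)) {T + real k + 1..}" by blast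
  then have "Ck_on (Suc k) B {T + real k + 1..}"
    using B(1) by (subst Ck_on_cong[where g = "\<lambda>t. h (window_conv \<kappa> B t)"]) auto
  then show ?case by (simp only: of_nat_Suc add.assoc add.commute[of 1])
qed

theorem theorem2p4:
  fixes \<mu> :: real
    and h \<gamma> \<phi> :: "real \<Rightarrow> real"
    and u :: "real \<times> real \<Rightarrow> real"
  assumes "\<mu> > 0"
    and "Cinf_on h UNIV"
    and "Cinf_on \<gamma> {0..1}"
    and "continuous_on {0..1} \<phi>"
    and "continuous_solution \<mu> h \<gamma> \<phi> u"
  shows "\<forall>k::nat. \<exists>T>0. Ck_on k u ({0..1} \<times> {T..})"
proof
  fix k :: nat
  define B where "B t = u (0, t)" for t
  define \<kappa> where "\<kappa> \<xi> = \<gamma> \<xi> * exp (- \<mu> * \<xi>)" for \<xi>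
  have cu: "continuous_on ({0..1} \<times> {0..}) u"
    using assms(5) by (simp add: continuous_solution_def)
  have u: "u (x, t) = exp (- \<mu> * x) * h (integral {0..1} (\<lambda>\<xi>. \<gamma> \<xi> * u (\<xi>, t - x)))"
      if "x \<in> {0..1}" "t > x" for x t
    using assms(5) that by (auto simp: continuous_solution_def)
  have B0: "B t = h (integral {0..1} (\<lambda>\<xi>. \<gamma> \<xi> * u (\<xi>, t)))" if "t > 0" for t
    using u[of 0 t] that by (simp add: B_def)
  have uB: "u (x, t) = exp (- \<mu> * x) * B (t - x)" if "x \<in> {0..1}" "t > 1" for x t
    using u[of x t] B0[of "t - x"] that by auto
  \<comment> \<open>For \<open>t > 1\<close> the whole slice \<open>[0, 1] \<times> {t}\<close> is given by \<open>uB\<close>.\<close>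
  have "B t = h (window_conv \<kappa> B t)" if "t > 1" for t
  proof -
    have "integral {0..1} (\<lambda>\<xi>. \<gamma> \<xi> * u (\<xi>, t)) = window_conv \<kappa> B t"
      unfolding window_conv_def \<kappa>_def using uB that by (intro integral_cong) auto
    then show ?thesis using B0 that by simp
  qed
  moreover have "continuous_on {1..} B"
    unfolding B_def by (intro continuous_on_compose2[OF cu] continuous_intros) auto
  moreover have "Ck_on 1 \<kappa> {0..1}"
  proof -
    have "Ck_on 1 \<gamma> {0..1}" using assms(3) by (simp only: Cinf_on_def)
    from Ck_on_mult[OF this Ck_on_compose[OF Ck_on_exp Ck_on_inner_left[of 1 "- \<mu>"]]]
    show ?thesis by (simp add: \<kappa>_def[abs_def])
  qed
  ultimately have B: "Ck_on k B {1 + real k..}"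
    using delay_equation_smoothing assms(2) by blast
  \<comment> \<open>The time \<open>2 + k\<close> makes \<open>t - x \<ge> 1 + k\<close> for all \<open>x \<le> 1\<close>, and the factors of \<open>u\<close> are
    functions of linear forms in \<open>(x, t)\<close>: \<open>(- \<mu>, 0) \<bullet> (x, t) = - \<mu> * x\<close> and
    \<open>(- 1, 1) \<bullet> (x, t) = t - x\<close>.\<close>
  define S where "S = {0..1::real} \<times> {2 + real k..}"
  have "Ck_on k (\<lambda>p. exp ((- \<mu>, 0) \<bullet> p) * B ((- 1, 1) \<bullet> p)) S"
    by (intro Ck_on_mult Ck_on_compose[OF Ck_on_exp] Ck_on_compose[OF B] Ck_on_inner_left)
      (auto simp: S_def)
  moreover have "u p = exp ((- \<mu>, 0) \<bullet> p) * B ((- 1, 1) \<bullet> p)" if "p \<in> S" for p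
    using uB[of "fst p" "snd p"] that by (auto simp: S_def)
  ultimately have "Ck_on k u S" by (subst Ck_on_cong)
  then show "\<exists>T>0. Ck_on k u ({0..1} \<times> {T..})"
    unfolding S_def by (intro exI[of _ "2 + real k"]) auto
qed

end
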